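(* Let $X$ be a topological space with a scaling $T$, let $\sim$ be an equivalence relation on $X$ such that $x\sim y$ implies $T_tx\sim T_ty$ for all $t>0$, and let $\tilde X$ be the quotient space with the quotient topology, quotient map $q:X\to\tilde X$ and induced scaling $\tilde T_t(qx)=q(T_tx)$. Let $\mathcal{S}$ be a topologically and scaling consistent ideal on $X$, put $[\mathcal{S}]=\{B\in\mathcal{S}:[B]\in\mathcal{S}\}$, where $[B]=q^{-1}(qB)$, and let $q\mathcal{S}=\{qB:B\in[\mathcal{S}]\}$ be the induced ideal on $\tilde X$. Assume that $\tilde T$ is a Baire measurable scaling on $\tilde X$ and that $q\mathcal{S}$ is topologically consistent. If $\xi\in\mathrm{RV}(X,T,\mathcal{S},g,\mu)$ and $\mu(B)>0$ for some $B\in[\mathcal{S}]$, then $$q\xi\in\mathrm{RV}(\tilde X,\tilde T,q\mathcal{S},g,\tilde\mu),$$ where $\tilde\mu$ is the pushforward under $q$ of the restriction of $\mu$ to the union of the sets in $[\mathcal{S}]$.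
   Context: The Baire $\sigma$-algebra $\mathcal{B}a(X)$ is the smallest $\sigma$-algebra making all continuous functions $X\to\mathbb{R}$ measurable. Functionally closed sets are zero sets of continuous real functions; functionally open sets are their complements. A scaling is a family of maps $T_t:X\to X$, $t>0$, with $T_tT_s=T_{ts}$, $T_1=\mathrm{id}$ and $(x,t)\mapsto T_tx$ being $\mathcal{B}a(X)\otimes\mathcal{B}((0,\infty))/\mathcal{B}a(X)$-measurable. The quotient topology is the finest topology on $\tilde X$ making $q$ continuous. An ideal $\mathcal{S}$ on $X$ is a family of subsets closed under finite unions and taking subsets; $U_{\mathcal{S}}$ is its union. It is scaling consistent if $T_tB\in\mathcal{S}$ for all $B\in\mathcal{S}$, $t>0$; topologically consistent if each $B\in\mathcal{S}$ is contained in a functionally closed member of $\mathcal{S}$ and each $x\in U_{\mathcal{S}}$ has a functionally open neighbourhood in $\mathcal{S}$. For a Baire measurable random element $\xi$ in $X$, $\xi\in\mathrm{RV}(X,T,\mathcal{S},g,\mu)$ means: $\mathcal{S}$ is topologically and scaling consistent; $g:[0,\infty)\to[0,\infty)$ is measurable with $g(t)\to\infty$ as $t\to\infty$; $\mu$ is a Baire measure which is finite on Baire sets in $\mathcal{S}$, vanishes outside $U_{\mathcal{S}}$, and satisfies $\mu(B)>0$ for some $B\in\mathcal{S}$; and $g(t)\mathbf{E}f(T_{t^{-1}}\xi)\to\int f\,d\mu$ as $t\to\infty$ for all bounded continuous $f:U_{\mathcal{S}}\to\mathbb{R}$ whose support (closure in $X$ of $\{f\ne0\}$) belongs to $\mathcal{S}$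 (extended by zero). *)

theory Defs
  imports "HOL-Probability.Probability"
begin

definition functionally_closed :: "'a topology \<Rightarrow> 'a set \<Rightarrow> bool" where
  "functionally_closed X F \<longleftrightarrow>
     (\<exists>f. continuous_map X euclideanreal f \<and> F = {x \<in> topspace X. f x = 0})"

definition functionally_open :: "'a topology \<Rightarrow> 'a set \<Rightarrow> bool" where
  "functionally_open X V \<longleftrightarrow> (\<exists>F. functionally_closed X F \<and> V = topspace X - F)"

text \<open>The Baire \<open>\<sigma>\<close>-algebra, as a measurable space (all measures zero).\<close>

definition baire :: "'a topology \<Rightarrow> 'a measure" where
  "baire X = sigma (topspace X)
     {f -` B \<inter> topspace X | f B. continuous_map X euclideanreal f \<and> B \<in> sets borel}"

lemma space_baire [simp]: "space (baire X) = topspace X"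
  unfolding baire_def by (rule space_measure_of) auto

lemma continuous_map_measurable_baire:
  assumes "continuous_map X euclideanreal f"
  shows "f \<in> borel_measurable (baire X)"
  unfolding baire_def using assms
  by (intro measurableI) (auto simp: space_measure_of_conv intro!: in_measure_of)

definition scaling :: "'a topology \<Rightarrow> (real \<Rightarrow> 'a \<Rightarrow> 'a) \<Rightarrow> bool" where
  "scaling X T \<longleftrightarrow>
     (\<forall>t>0. T t ` topspace X \<subseteq> topspace X) \<and>
     (\<forall>t>0. \<forall>s>0. \<forall>x\<in>topspace X. T t (T s x) = T (t * s) x) \<and>
     (\<forall>x\<in>topspace X. T 1 x = x) \<and>
     (\<lambda>(x, t). T t x) \<in> baire X \<Otimes>\<^sub>M restrict_space borel {0<..} \<rightarrow>\<^sub>M baire X"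

text \<open>Closure under finite unions includes the empty union.\<close>

definition ideal_on :: "'a set \<Rightarrow> 'a set set \<Rightarrow> bool" where
  "ideal_on A S \<longleftrightarrow>
     S \<subseteq> Pow A \<and> {} \<in> S \<and> (\<forall>B\<in>S. \<forall>C\<in>S. B \<union> C \<in> S) \<and> (\<forall>B\<in>S. \<forall>C. C \<subseteq> B \<longrightarrow> C \<in> S)"

definition scaling_consistent :: "(real \<Rightarrow> 'a \<Rightarrow> 'a) \<Rightarrow> 'a set set \<Rightarrow> bool" where
  "scaling_consistent T S \<longleftrightarrow> (\<forall>B\<in>S. \<forall>t>0. T t ` B \<in> S)"

definition topologically_consistent :: "'a topology \<Rightarrow> 'a set set \<Rightarrow> bool" where
  "topologically_consistent X S \<longleftrightarrow>
     (\<forall>B\<in>S. \<exists>F\<in>S. functionally_closed X F \<and> B \<subseteq> F) \<and>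
     (\<forall>x\<in>\<Union>S. \<exists>V\<in>S. functionally_open X V \<and> x \<in> V)"

definition zero_extension :: "'a set \<Rightarrow> ('a \<Rightarrow> real) \<Rightarrow> 'a \<Rightarrow> real" where
  "zero_extension U f x = (if x \<in> U then f x else 0)"

definition test_function :: "'a topology \<Rightarrow> 'a set set \<Rightarrow> ('a \<Rightarrow> real) \<Rightarrow> bool" where
  "test_function X S f \<longleftrightarrow>
     continuous_map (subtopology X (\<Union>S)) euclideanreal f \<and>
     bounded (f ` \<Union>S) \<and>
     X closure_of {x \<in> \<Union>S. f x \<noteq> 0} \<in> S"

text \<open>
  The random element \<open>\<xi>\<close> is defined on the probability space \<open>P\<close>.  As \<open>\<Union>S\<close> need not be a Baire set,
  ``\<open>\<mu>\<close> vanishes outside \<open>\<Union>S\<close>'' means that Baire sets disjoint from \<open>\<Union>S\<close> are null.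
\<close>

definition RV ::
  "'w measure \<Rightarrow> ('w \<Rightarrow> 'a) \<Rightarrow> 'a topology \<Rightarrow> (real \<Rightarrow> 'a \<Rightarrow> 'a) \<Rightarrow> 'a set set \<Rightarrow>
     (real \<Rightarrow> real) \<Rightarrow> 'a measure \<Rightarrow> bool" where
  "RV P \<xi> X T S g \<mu> \<longleftrightarrow>
     prob_space P \<and> \<xi> \<in> P \<rightarrow>\<^sub>M baire X \<and>
     ideal_on (topspace X) S \<and> topologically_consistent X S \<and> scaling_consistent T S \<and>
     g \<in> borel_measurable (restrict_space borel {0..}) \<and> (\<forall>t\<ge>0. g t \<ge> 0) \<and>
     filterlim g at_top at_top \<and>
     sets \<mu> = sets (baire X) \<and>
     (\<forall>B\<in>S \<inter> sets (baire X). emeasure \<mu> B < \<infinity>) \<and>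
     (\<forall>B\<in>sets (baire X). B \<inter> \<Union>S = {} \<longrightarrow> emeasure \<mu> B = 0) \<and>
     (\<exists>B\<in>S \<inter> sets (baire X). emeasure \<mu> B > 0) \<and>
     (\<forall>f. test_function X S f \<longrightarrow>
        ((\<lambda>t. g t * (\<integral>\<omega>. zero_extension (\<Union>S) f (T (inverse t) (\<xi> \<omega>)) \<partial>P))
           \<longlongrightarrow> (\<integral>x. zero_extension (\<Union>S) f x \<partial>\<mu>)) at_top)"

abbreviation quotient_proj :: "('a \<times> 'a) set \<Rightarrow> 'a \<Rightarrow> 'a set" where
  "quotient_proj r x \<equiv> r `` {x}"

definition quotient_topology :: "'a topology \<Rightarrow> ('a \<times> 'a) set \<Rightarrow> 'a set topology" where
  "quotient_topology X r = topology (\<lambda>U. U \<subseteq> topspace X // r \<and>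
     openin X {x \<in> topspace X. quotient_proj r x \<in> U})"

lemma openin_quotient_topology:
  "openin (quotient_topology X r) U \<longleftrightarrow>
     U \<subseteq> topspace X // r \<and> openin X {x \<in> topspace X. quotient_proj r x \<in> U}"
proof -
  have "istopology (\<lambda>U. U \<subseteq> topspace X // r \<and> openin X {x \<in> topspace X. quotient_proj r x \<in> U})"
    unfolding istopology_def
  proof (intro conjI allI impI; (elim conjE)?)
    fix U V assume "U \<subseteq> topspace X // r" then show "U \<inter> V \<subseteq> topspace X // r" by blast
  next
    fix U V
    assume "openin X {x \<in> topspace X. quotient_proj r x \<in> U}"
      and "openin X {x \<in> topspace X. quotient_proj r x \<in> V}"
    then have "openin X ({x \<in> topspace X. quotient_proj r x \<in> U} \<inter>
                         {x \<in> topspace X. quotient_proj r x \<in> V})"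
      by (rule openin_Int)
    also have "\<dots> = {x \<in> topspace X. quotient_proj r x \<in> U \<inter> V}" by blast
    finally show "openin X {x \<in> topspace X. quotient_proj r x \<in> U \<inter> V}" .
  next
    fix K
    assume "\<forall>U\<in>K. U \<subseteq> topspace X // r \<and> openin X {x \<in> topspace X. quotient_proj r x \<in> U}"
    then have "\<Union>K \<subseteq> topspace X // r"
      and "openin X (\<Union>U\<in>K. {x \<in> topspace X. quotient_proj r x \<in> U})"
      by (blast, blast)
    moreover have "(\<Union>U\<in>K. {x \<in> topspace X. quotient_proj r x \<in> U}) =
        {x \<in> topspace X. quotient_proj r x \<in> \<Union>K}" by blast
    ultimately show "\<Union>K \<subseteq> topspace X // r"
      and "openin X {x \<in> topspace X. quotient_proj r x \<in> \<Union>K}" by simp_all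
  qed
  then show ?thesis by (simp add: quotient_topology_def)
qed

lemma topspace_quotient_topology [simp]: "topspace (quotient_topology X r) = topspace X // r"
proof -
  have "{x \<in> topspace X. quotient_proj r x \<in> topspace X // r} = topspace X"
    by (auto simp: quotient_def)
  then have "openin (quotient_topology X r) (topspace X // r)"
    by (simp add: openin_quotient_topology)
  then show ?thesis
    by (metis openin_quotient_topology openin_subset openin_topspace subset_antisym)
qed

lemma quotient_map_quotient_proj: "quotient_map X (quotient_topology X r) (quotient_proj r)"
  by (auto simp: quotient_map_def openin_quotient_topology quotient_def)

lemma quotient_topology_finest:
  assumes "topspace Y = topspace X // r" "continuous_map X Y (quotient_proj r)" "openin Y U"
  shows "openin (quotient_topology X r) U"
  using assms openin_continuous_map_preimage[OF assms(2,3)] openin_subset[OF assms(3)]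
  by (simp add: openin_quotient_topology)

text \<open>The saturation \<open>[B] = q\<^sup>-\<^sup>1(q B)\<close>, the family \<open>[S]\<close> and the induced ideal \<open>q S\<close>.\<close>

definition saturation :: "'a topology \<Rightarrow> ('a \<times> 'a) set \<Rightarrow> 'a set \<Rightarrow> 'a set" where
  "saturation X r B = {x \<in> topspace X. quotient_proj r x \<in> quotient_proj r ` B}"

definition saturated_part :: "'a topology \<Rightarrow> ('a \<times> 'a) set \<Rightarrow> 'a set set \<Rightarrow> 'a set set" where
  "saturated_part X r S = {B \<in> S. saturation X r B \<in> S}"

definition quotient_ideal :: "'a topology \<Rightarrow> ('a \<times> 'a) set \<Rightarrow> 'a set set \<Rightarrow> 'a set set set" where
  "quotient_ideal X r S = (\<lambda>B. quotient_proj r ` B) ` saturated_part X r S"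

text \<open>
  The restriction of a measure \<open>M\<close> to a set \<open>U\<close>, as a measure on the \<open>\<sigma>\<close>-algebra of \<open>M\<close>.  If \<open>U\<close> is
  measurable, this is \<open>A \<mapsto> M (A \<inter> U)\<close>; in general (a union of sets in an ideal need not be a Baire
  set) it is the trace \<open>A \<mapsto> M\<^sup>* (A \<inter> U)\<close> of the outer measure, which is always a measure.
\<close>

definition restrict_measure :: "'a measure \<Rightarrow> 'a set \<Rightarrow> 'a measure" where
  "restrict_measure M U = measure_of (space M) (sets M) (\<lambda>A. outer_measure_of M (A \<inter> U))"

lemma space_restrict_measure [simp]: "space (restrict_measure M U) = space M"
  by (simp add: restrict_measure_def)

lemma sets_restrict_measure [simp, measurable_cong]: "sets (restrict_measure M U) = sets M"
  by (simp add: restrict_measure_def)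

lemma emeasure_restrict_measure:
  assumes "A \<in> sets M"
  shows "emeasure (restrict_measure M U) A = outer_measure_of M (A \<inter> U)"
  unfolding restrict_measure_def
proof (rule emeasure_measure_of_sigma)
  show "sigma_algebra (space M) (sets M)" by (rule sets.sigma_algebra_axioms)
  show "positive (sets M) (\<lambda>A. outer_measure_of M (A \<inter> U))" by (simp add: positive_def)
  show "countably_additive (sets M) (\<lambda>A. outer_measure_of M (A \<inter> U))"
  proof (rule countably_additiveI)
    fix A :: "nat \<Rightarrow> 'a set"
    assume A: "range A \<subseteq> sets M" "disjoint_family A" "(\<Union>i. A i) \<in> sets M"
    have Asp: "A i \<inter> U \<subseteq> space M" "(\<Union>i. A i) \<inter> U \<subseteq> space M" for i
      using A sets.sets_into_space by blast+
    obtain C where C: "C \<in> sets M" "(\<Union>i. A i) \<inter> U \<subseteq> C"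
        "outer_measure_of M ((\<Union>i. A i) \<inter> U) = emeasure M C"
      using outer_measure_of_attain[OF Asp(2)] by blast
    have "(\<Sum>i. outer_measure_of M (A i \<inter> U)) \<le> (\<Sum>i. emeasure M (A i \<inter> C))"
    proof (intro suminf_le summableI)
      fix i
      have "outer_measure_of M (A i \<inter> U) \<le> outer_measure_of M (A i \<inter> C)"
        using C(2) by (intro outer_measure_of_mono) auto
      then show "outer_measure_of M (A i \<inter> U) \<le> emeasure M (A i \<inter> C)"
        using A C(1) by (simp add: image_subset_iff sets.Int)
    qed
    also have "\<dots> = emeasure M (\<Union>i. A i \<inter> C)"
      using A C(1) by (intro suminf_emeasure) (auto simp: disjoint_family_on_def)
    also have "\<dots> \<le> emeasure M C"
      using C(1) by (intro emeasure_mono) auto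
    finally have le: "(\<Sum>i. outer_measure_of M (A i \<inter> U)) \<le> outer_measure_of M ((\<Union>i. A i) \<inter> U)"
      using C(3) by simp
    have "\<forall>i. \<exists>D\<in>sets M. A i \<inter> U \<subseteq> D \<and> outer_measure_of M (A i \<inter> U) = emeasure M D"
      using outer_measure_of_attain[OF Asp(1)] by blast
    then obtain D where D: "\<And>i. D i \<in> sets M" "\<And>i. A i \<inter> U \<subseteq> D i"
        "\<And>i. outer_measure_of M (A i \<inter> U) = emeasure M (D i)"
      by metis
    have "outer_measure_of M ((\<Union>i. A i) \<inter> U) \<le> outer_measure_of M (\<Union>i. D i)"
      using D(2) by (intro outer_measure_of_mono) blast
    also have "\<dots> = emeasure M (\<Union>i. D i)"
      using D(1) by (intro outer_measure_of_eq sets.countable_UN) auto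
    also have "\<dots> \<le> (\<Sum>i. emeasure M (D i))"
      using D(1) by (intro emeasure_subadditive_countably) auto
    finally show "(\<Sum>i. outer_measure_of M (A i \<inter> U)) = outer_measure_of M ((\<Union>i. A i) \<inter> U)"
      using le D(3) by (simp add: antisym)
  qed
qed (fact assms)

lemma emeasure_restrict_measure_sets:
  assumes "A \<in> sets M" "U \<in> sets M"
  shows "emeasure (restrict_measure M U) A = emeasure M (A \<inter> U)"
  using assms by (simp add: emeasure_restrict_measure sets.Int)

definition quotient_measure ::
  "'a topology \<Rightarrow> ('a \<times> 'a) set \<Rightarrow> 'a set set \<Rightarrow> 'a measure \<Rightarrow> 'a set measure" where
  "quotient_measure X r S \<mu> =
     distr (restrict_measure \<mu> (\<Union>(saturated_part X r S)))
           (baire (quotient_topology X r)) (quotient_proj r)"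

end

theory Submission
  imports Defs
begin

text \<open>
  The quotient map \<open>q\<close> is continuous, hence Baire measurable, and the induced ideal consists of exactly
  those sets \<open>C\<close> of classes whose preimage under \<open>q\<close> lies in \<open>S\<close> (\<open>quotient_ideal_iff\<close>).  By this
  description, closure under unions, subsets and scaling passes from \<open>S\<close> to the induced ideal.

  The limit relation for a test function on the quotient is the one for its pullback: such an \<open>f\<close>
  extended by zero is continuous because the union of a topologically consistent
  ideal is open and contains the closed support of \<open>f\<close> (\<open>continuous_map_zero_extension\<close>); its
  composition with \<open>q\<close> is then a test function on \<open>X\<close> (\<open>test_function_pullback\<close>), and since
  \<open>q (T t x) = Tq t (q x)\<close>, the expectations agree.

  It remains to match the limits, that is, the integrals with respect to \<open>\<mu>\<close> and to its restriction
  to the union of the saturated part of \<open>S\<close>.  This union need not be a Baire set.  The support of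
  \<open>f\<close>, however, lies in a functionally closed member of the induced ideal, whose preimage is a Baire
  set inside the union.  On such a set the restricted measure agrees with \<open>\<mu>\<close>, so the integrals do
  too (\<open>integral_restrict_measure_eq\<close>).
\<close>

section \<open>Baire sets and test functions\<close>

lemma sets_baire_functionally_closed:
  assumes "functionally_closed X F"
  shows "F \<in> sets (baire X)"
proof -
  obtain f where f: "continuous_map X euclideanreal f" "F = {x \<in> topspace X. f x = 0}"
    using assms by (auto simp: functionally_closed_def)
  have "f -` {0} \<inter> space (baire X) \<in> sets (baire X)"
    by (intro measurable_sets[OF continuous_map_measurable_baire[OF f(1)]]) auto
  also have "f -` {0} \<inter> space (baire X) = F"
    using f(2) by auto
  finally show ?thesis .
qed

lemma openin_functionally_open:
  assumes "functionally_open X V"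
  shows "openin X V"
proof -
  obtain f where f: "continuous_map X euclideanreal f" "V = topspace X - {x \<in> topspace X. f x = 0}"
    using assms by (auto simp: functionally_open_def functionally_closed_def)
  have "closedin X {x \<in> topspace X. f x \<in> {0}}"
    by (rule closedin_continuous_map_preimage[OF f(1)]) auto
  then show ?thesis
    using f(2) by auto
qed

lemma continuous_map_measurable_baire_baire:
  assumes "continuous_map X Y p"
  shows "p \<in> baire X \<rightarrow>\<^sub>M baire Y"
  unfolding baire_def[of Y]
proof (rule measurable_measure_of)
  show "p \<in> space (baire X) \<rightarrow> topspace Y"
    using assms by (auto simp: continuous_map_def)
  fix A assume "A \<in> {f -` B \<inter> topspace Y |f B. continuous_map Y euclideanreal f \<and> B \<in> sets borel}"
  then obtain f B where f: "A = f -` B \<inter> topspace Y" "continuous_map Y euclideanreal f" "B \<in> sets borel"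
    by blast
  have "(f \<circ> p) -` B \<inter> space (baire X) \<in> sets (baire X)"
    using continuous_map_measurable_baire[OF continuous_map_compose[OF assms f(2)]] f(3)
    by (rule measurable_sets)
  also have "(f \<circ> p) -` B \<inter> space (baire X) = p -` A \<inter> space (baire X)"
    using assms f(1) by (auto simp: continuous_map_def)
  finally show "p -` A \<inter> space (baire X) \<in> sets (baire X)" .
qed auto

lemma topologically_consistentD:
  assumes "topologically_consistent X S" "B \<in> S"
  shows "\<exists>F\<in>S. functionally_closed X F \<and> B \<subseteq> F"
  using assms by (simp add: topologically_consistent_def)

lemma openin_Union_topologically_consistent:
  assumes "topologically_consistent X S"
  shows "openin X (\<Union>S)"
proof -
  have "\<exists>V. openin X V \<and> x \<in> V \<and> V \<subseteq> \<Union>S" if x: "x \<in> \<Union>S" for x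
  proof -
    obtain V where "V \<in> S" "functionally_open X V" "x \<in> V"
      using assms x unfolding topologically_consistent_def by meson
    then show ?thesis
      using openin_functionally_open[of X V] by (intro exI[of _ V]) auto
  qed
  then show ?thesis
    using openin_subopen[of X "\<Union>S"] by blast
qed

text \<open>
  The space is covered by two open sets: the union of the ideal, where the extension is the given
  continuous function, and the complement of the support, where it vanishes.
\<close>

lemma continuous_map_zero_extension:
  assumes S: "topologically_consistent X S" "S \<subseteq> Pow (topspace X)"
    and f: "test_function X S f"
  shows "continuous_map X euclideanreal (zero_extension (\<Union>S) f)"
proof -
  define K where "K = X closure_of {x \<in> \<Union>S. f x \<noteq> 0}"
  have K: "K \<in> S" "closedin X K" "{x \<in> \<Union>S. f x \<noteq> 0} \<subseteq> K"
    using f S(2) by (auto simp: test_function_def K_def intro!: closure_of_subset[THEN subsetD])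
  have zero: "zero_extension (\<Union>S) f x = 0" if "x \<notin> K" for x
    using that K(3) by (auto simp: zero_extension_def)
  have cont_U: "continuous_map (subtopology X (\<Union>S)) euclideanreal (zero_extension (\<Union>S) f)"
    by (rule continuous_map_eq[where f = f])
       (use f in \<open>auto simp: test_function_def zero_extension_def\<close>)
  have cont_K: "continuous_map (subtopology X (topspace X - K)) euclideanreal (zero_extension (\<Union>S) f)"
    by (rule continuous_map_eq[where f = "\<lambda>_. 0"]) (auto simp: zero)
  show ?thesis
  proof (rule pasting_lemma[where I = "{\<Union>S, topspace X - K}" and T = "\<lambda>i. i"
        and f = "\<lambda>_. zero_extension (\<Union>S) f"])
    fix i assume "i \<in> {\<Union>S, topspace X - K}"
    then show "openin X i"
      using openin_Union_topologically_consistent[OF S(1)] K(2) by auto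
  next
    fix i assume "i \<in> {\<Union>S, topspace X - K}"
    then show "continuous_map (subtopology X i) euclideanreal (zero_extension (\<Union>S) f)"
      using cont_U cont_K by auto
  next
    fix x assume "x \<in> topspace X"
    then show "\<exists>j. j \<in> {\<Union>S, topspace X - K} \<and> x \<in> j \<and>
        zero_extension (\<Union>S) f x = zero_extension (\<Union>S) f x"
      using K(1) by auto
  qed auto
qed

section \<open>Restricting a measure to a set that need not be measurable\<close>

lemma measurable_restrict_measure [simp]:
  "restrict_measure M U \<rightarrow>\<^sub>M N = M \<rightarrow>\<^sub>M N"
  by (rule measurable_cong_sets) simp_all

text \<open>
  Multiplying either measure by the indicator of \<open>G\<close> gives the same measure, since the outer measure
  of a measurable subset of \<open>U\<close> is its measure.
\<close>

lemma integral_restrict_measure_eq: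
  fixes f :: "'a \<Rightarrow> real"
  assumes G: "G \<in> sets M" "G \<subseteq> U" and f: "f \<in> borel_measurable M"
    and supp: "\<And>x. x \<notin> G \<Longrightarrow> f x = 0"
  shows "(\<integral>x. f x \<partial>restrict_measure M U) = (\<integral>x. f x \<partial>M)"
proof -
  let ?R = "restrict_measure M U"
  have f': "f \<in> borel_measurable ?R"
    using f by simp
  have dens: "density ?R (indicator G) = density M (indicator G)"
  proof (rule measure_eqI)
    fix A assume "A \<in> sets (density ?R (indicator G))"
    then have A: "A \<in> sets M" by simp
    have "G \<inter> A \<inter> U = G \<inter> A" using G(2) by auto
    then have "emeasure ?R (G \<inter> A) = emeasure M (G \<inter> A)"
      using A G(1) by (simp add: emeasure_restrict_measure sets.Int)
    then show "emeasure (density ?R (indicator G)) A = emeasure (density M (indicator G)) A"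
      using A G(1) by (simp add: emeasure_density_const emeasure_restricted)
  qed simp
  have ind: "indicator G x *\<^sub>R f x = f x" for x
    using supp[of x] by (auto simp: indicator_def)
  have eq: "(\<integral>x. f x \<partial>density N (indicator G)) = (\<integral>x. f x \<partial>N)"
    if "G \<in> sets N" "f \<in> borel_measurable N" for N
  proof -
    have "(\<integral>x. f x \<partial>density N (\<lambda>x. ennreal (indicator G x))) = (\<integral>x. indicator G x *\<^sub>R f x \<partial>N)"
      using that by (intro integral_density) auto
    then show ?thesis
      unfolding ind ennreal_indicator .
  qed
  have "(\<integral>x. f x \<partial>?R) = (\<integral>x. f x \<partial>density ?R (indicator G))"
    using eq[of ?R] G(1) f' by simp
  also have "\<dots> = (\<integral>x. f x \<partial>density M (indicator G))"
    by (simp only: dens)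
  also have "\<dots> = (\<integral>x. f x \<partial>M)"
    by (rule eq[OF G(1) f])
  finally show ?thesis .
qed

section \<open>The induced ideal\<close>

lemma quotient_proj_image_vimage:
  assumes "C \<subseteq> A // r"
  shows "quotient_proj r ` (quotient_proj r -` C \<inter> A) = C"
  using assms by (auto simp: quotient_def)

lemma saturation_eq_vimage:
  "saturation X r B = quotient_proj r -` (quotient_proj r ` B) \<inter> topspace X"
  by (auto simp: saturation_def)

text \<open>
  The induced ideal is defined through images of sets in \<open>S\<close> with saturation in \<open>S\<close>; the largest
  such set with image \<open>C\<close> is the preimage of \<open>C\<close>, which is its own saturation.
\<close>

lemma quotient_ideal_iff:
  assumes "S \<subseteq> Pow (topspace X)"
  shows "C \<in> quotient_ideal X r S \<longleftrightarrow>
    C \<subseteq> topspace X // r \<and> quotient_proj r -` C \<inter> topspace X \<in> S"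
proof
  assume "C \<in> quotient_ideal X r S"
  then obtain B where "C = quotient_proj r ` B" "B \<in> S" "saturation X r B \<in> S"
    by (auto simp: quotient_ideal_def saturated_part_def)
  then show "C \<subseteq> topspace X // r \<and> quotient_proj r -` C \<inter> topspace X \<in> S"
    using assms by (auto simp: saturation_eq_vimage quotient_def)
next
  assume C: "C \<subseteq> topspace X // r \<and> quotient_proj r -` C \<inter> topspace X \<in> S"
  let ?B = "quotient_proj r -` C \<inter> topspace X"
  have img: "quotient_proj r ` ?B = C"
    using C quotient_proj_image_vimage by blast
  have "?B \<in> saturated_part X r S"
    using C by (simp add: saturated_part_def saturation_eq_vimage img)
  then show "C \<in> quotient_ideal X r S"
    unfolding quotient_ideal_def using img by (intro image_eqI[where x = ?B]) auto
qed

lemma vimage_subset_Union_saturated_part: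
  assumes "S \<subseteq> Pow (topspace X)" "C \<in> quotient_ideal X r S"
  shows "quotient_proj r -` C \<inter> topspace X \<subseteq> \<Union>(saturated_part X r S)"
proof -
  have C: "C \<subseteq> topspace X // r" "quotient_proj r -` C \<inter> topspace X \<in> S"
    using assms quotient_ideal_iff by blast+
  have "quotient_proj r -` C \<inter> topspace X \<in> saturated_part X r S"
    using C by (simp add: saturated_part_def saturation_eq_vimage quotient_proj_image_vimage)
  then show ?thesis by blast
qed

lemma ideal_on_quotient_ideal:
  assumes "ideal_on (topspace X) S"
  shows "ideal_on (topspace (quotient_topology X r)) (quotient_ideal X r S)"
proof -
  have S: "S \<subseteq> Pow (topspace X)" "{} \<in> S" "\<And>B C. B \<in> S \<Longrightarrow> C \<in> S \<Longrightarrow> B \<union> C \<in> S"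
      "\<And>B C. B \<in> S \<Longrightarrow> C \<subseteq> B \<Longrightarrow> C \<in> S"
    using assms by (auto simp: ideal_on_def)
  show ?thesis
    unfolding ideal_on_def topspace_quotient_topology
  proof (intro conjI ballI allI impI)
    fix B C assume "B \<in> quotient_ideal X r S" "C \<in> quotient_ideal X r S"
    then show "B \<union> C \<in> quotient_ideal X r S"
      using S(3) by (auto simp: quotient_ideal_iff[OF S(1)] vimage_Un Int_Un_distrib2)
  next
    fix B C assume "B \<in> quotient_ideal X r S" "C \<subseteq> B"
    moreover have "quotient_proj r -` C \<inter> topspace X \<subseteq> quotient_proj r -` B \<inter> topspace X"
      using \<open>C \<subseteq> B\<close> by blast
    ultimately show "C \<in> quotient_ideal X r S"
      using S(4) unfolding quotient_ideal_iff[OF S(1)] by blast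
  qed (use S in \<open>auto simp: quotient_ideal_iff[OF S(1)]\<close>)
qed

text \<open>
  If \<open>q x = Tq t c\<close>, then \<open>y = T (1/t) x\<close> satisfies \<open>q y = c\<close> and \<open>x = T t y\<close>; hence the preimage
  of \<open>Tq t ` C\<close> is contained in the image of the preimage of \<open>C\<close> under \<open>T t\<close>, which is in \<open>S\<close>.
\<close>

lemma scaling_consistent_quotient_ideal:
  assumes T: "scaling X T" and Tq: "scaling (quotient_topology X r) Tq"
    and comm: "\<And>x t. x \<in> topspace X \<Longrightarrow> t > 0 \<Longrightarrow> Tq t (quotient_proj r x) = quotient_proj r (T t x)"
    and ideal: "ideal_on (topspace X) S" and S: "scaling_consistent T S"
  shows "scaling_consistent Tq (quotient_ideal X r S)"
  unfolding scaling_consistent_def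
proof (intro ballI allI impI)
  fix C and t :: real assume C: "C \<in> quotient_ideal X r S" and t: "t > 0"
  have S': "S \<subseteq> Pow (topspace X)" "\<And>B C. B \<in> S \<Longrightarrow> C \<subseteq> B \<Longrightarrow> C \<in> S"
    using ideal by (auto simp: ideal_on_def)
  have C': "C \<subseteq> topspace X // r" "quotient_proj r -` C \<inter> topspace X \<in> S"
    using C quotient_ideal_iff[OF S'(1)] by blast+
  have "quotient_proj r -` (Tq t ` C) \<inter> topspace X \<subseteq> T t ` (quotient_proj r -` C \<inter> topspace X)"
  proof
    fix x assume x: "x \<in> quotient_proj r -` (Tq t ` C) \<inter> topspace X"
    then obtain c where c: "c \<in> C" "quotient_proj r x = Tq t c" by auto
    have "quotient_proj r (T (inverse t) x) = Tq (inverse t) (Tq t c)"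
      using comm[of x "inverse t"] x t c by simp
    also have "\<dots> = c"
      using Tq t c C'(1) by (auto simp: scaling_def subset_iff)
    finally have "T (inverse t) x \<in> quotient_proj r -` C \<inter> topspace X"
      using c(1) T t x by (auto simp: scaling_def image_subset_iff)
    moreover have "x = T t (T (inverse t) x)"
      using T t x by (auto simp: scaling_def)
    ultimately show "x \<in> T t ` (quotient_proj r -` C \<inter> topspace X)" by (rule rev_image_eqI)
  qed
  moreover have "T t ` (quotient_proj r -` C \<inter> topspace X) \<in> S"
    using S C'(2) t by (auto simp: scaling_consistent_def)
  ultimately have "quotient_proj r -` (Tq t ` C) \<inter> topspace X \<in> S"
    using S'(2) by metis
  moreover have "Tq t ` C \<subseteq> topspace X // r"
    using Tq t C'(1) by (auto simp: scaling_def image_subset_iff)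
  ultimately show "Tq t ` C \<in> quotient_ideal X r S"
    by (simp add: quotient_ideal_iff[OF S'(1)])
qed

text \<open>
  The support of the pullback is contained in the preimage of the support of \<open>f\<close>, a closed set
  belonging to \<open>S\<close>.
\<close>

lemma test_function_pullback:
  assumes ideal: "ideal_on (topspace X) S"
    and tc: "topologically_consistent (quotient_topology X r) (quotient_ideal X r S)"
    and f: "test_function (quotient_topology X r) (quotient_ideal X r S) f"
  defines "h \<equiv> zero_extension (\<Union>(quotient_ideal X r S)) f"
  shows "test_function X S (\<lambda>x. h (quotient_proj r x))"
  unfolding test_function_def
proof (intro conjI)
  let ?Q = "quotient_topology X r" and ?qS = "quotient_ideal X r S"
  have S: "S \<subseteq> Pow (topspace X)" "\<And>B C. B \<in> S \<Longrightarrow> C \<subseteq> B \<Longrightarrow> C \<in> S"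
    using ideal by (auto simp: ideal_on_def)
  have qS: "?qS \<subseteq> Pow (topspace ?Q)"
    using ideal_on_quotient_ideal[OF ideal] by (auto simp: ideal_on_def)
  have q: "continuous_map X ?Q (quotient_proj r)"
    by (rule quotient_imp_continuous_map[OF quotient_map_quotient_proj])
  have h: "continuous_map ?Q euclideanreal h"
    unfolding h_def by (rule continuous_map_zero_extension[OF tc qS f])
  show "continuous_map (subtopology X (\<Union>S)) euclideanreal (\<lambda>x. h (quotient_proj r x))"
    using continuous_map_compose[OF q h]
    by (intro continuous_map_from_subtopology) (simp add: comp_def)
  have "(\<lambda>x. h (quotient_proj r x)) ` \<Union>S \<subseteq> insert 0 (f ` \<Union>?qS)"
    by (auto simp: h_def zero_extension_def)
  moreover have "bounded (insert 0 (f ` \<Union>?qS))"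
    using f by (simp add: test_function_def)
  ultimately show "bounded ((\<lambda>x. h (quotient_proj r x)) ` \<Union>S)"
    using bounded_subset by blast
  define K where "K = ?Q closure_of {c \<in> \<Union>?qS. f c \<noteq> 0}"
  have K: "K \<in> ?qS" "closedin ?Q K" "{c \<in> \<Union>?qS. f c \<noteq> 0} \<subseteq> K"
    using f qS closure_of_subset[of "{c \<in> \<Union>?qS. f c \<noteq> 0}" ?Q]
    by (auto simp: test_function_def K_def)
  have pre: "{x \<in> topspace X. quotient_proj r x \<in> K} = quotient_proj r -` K \<inter> topspace X"
    by blast
  have "X closure_of {x \<in> \<Union>S. h (quotient_proj r x) \<noteq> 0} \<subseteq> quotient_proj r -` K \<inter> topspace X"
  proof (rule closure_of_minimal)
    show "closedin X (quotient_proj r -` K \<inter> topspace X)"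
      using closedin_continuous_map_preimage[OF q K(2)] by (simp only: pre)
    show "{x \<in> \<Union>S. h (quotient_proj r x) \<noteq> 0} \<subseteq> quotient_proj r -` K \<inter> topspace X"
      using K(3) S(1) by (auto simp: h_def zero_extension_def split: if_splits)
  qed
  moreover have "quotient_proj r -` K \<inter> topspace X \<in> S"
    using K(1) quotient_ideal_iff[OF S(1)] by blast
  ultimately show "X closure_of {x \<in> \<Union>S. h (quotient_proj r x) \<noteq> 0} \<in> S"
    using S(2) by blast
qed

section \<open>The quotient measure and the limit\<close>

lemma measurable_quotient_proj:
  "quotient_proj r \<in> baire X \<rightarrow>\<^sub>M baire (quotient_topology X r)"
  by (intro continuous_map_measurable_baire_baire quotient_imp_continuous_map
      quotient_map_quotient_proj)

lemma emeasure_quotient_measure: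
  assumes "sets \<mu> = sets (baire X)" "C \<in> sets (baire (quotient_topology X r))"
  shows "emeasure (quotient_measure X r S \<mu>) C =
    outer_measure_of \<mu> (quotient_proj r -` C \<inter> topspace X \<inter> \<Union>(saturated_part X r S))"
proof -
  have sp: "space \<mu> = topspace X"
    using sets_eq_imp_space_eq[OF assms(1)] by simp
  have "quotient_proj r \<in> \<mu> \<rightarrow>\<^sub>M baire (quotient_topology X r)"
    using measurable_quotient_proj measurable_cong_sets[OF assms(1) refl] by blast
  moreover from this have "quotient_proj r -` C \<inter> topspace X \<in> sets \<mu>"
    using measurable_sets[OF _ assms(2)] sp by metis
  ultimately show ?thesis
    using assms(2) sp unfolding quotient_measure_def
    by (subst emeasure_distr)
       (simp_all add: emeasure_restrict_measure)
qed

text \<open>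
  On members of the induced ideal the restriction in the definition of the quotient measure has no
  effect, since their preimages lie in the set to which the measure is restricted.
\<close>

lemma emeasure_quotient_measure_ideal:
  assumes "sets \<mu> = sets (baire X)" "S \<subseteq> Pow (topspace X)"
    and "C \<in> sets (baire (quotient_topology X r))" "C \<in> quotient_ideal X r S"
  shows "emeasure (quotient_measure X r S \<mu>) C = emeasure \<mu> (quotient_proj r -` C \<inter> topspace X)"
proof -
  have "quotient_proj r -` C \<inter> topspace X \<in> sets \<mu>"
    using measurable_sets[OF measurable_quotient_proj assms(3)] assms(1) by simp
  moreover have "quotient_proj r -` C \<inter> topspace X \<inter> \<Union>(saturated_part X r S) =
      quotient_proj r -` C \<inter> topspace X"
    using vimage_subset_Union_saturated_part[OF assms(2,4)] by blast
  ultimately show ?thesis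
    by (simp add: emeasure_quotient_measure[OF assms(1,3)])
qed

lemma integral_quotient_measure:
  assumes \<mu>: "sets \<mu> = sets (baire X)" and ideal: "ideal_on (topspace X) S"
    and tc: "topologically_consistent (quotient_topology X r) (quotient_ideal X r S)"
    and f: "test_function (quotient_topology X r) (quotient_ideal X r S) f"
  defines "h \<equiv> zero_extension (\<Union>(quotient_ideal X r S)) f"
  shows "(\<integral>c. h c \<partial>quotient_measure X r S \<mu>) = (\<integral>x. h (quotient_proj r x) \<partial>\<mu>)"
proof -
  let ?Q = "quotient_topology X r" and ?qS = "quotient_ideal X r S"
  let ?R = "restrict_measure \<mu> (\<Union>(saturated_part X r S))"
  have S: "S \<subseteq> Pow (topspace X)"
    using ideal by (auto simp: ideal_on_def)
  have qS: "?qS \<subseteq> Pow (topspace ?Q)"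
    using ideal_on_quotient_ideal[OF ideal] by (auto simp: ideal_on_def)
  have sp: "space \<mu> = topspace X"
    using sets_eq_imp_space_eq[OF \<mu>] by simp
  have h: "h \<in> borel_measurable (baire ?Q)"
    unfolding h_def
    by (intro continuous_map_measurable_baire continuous_map_zero_extension[OF tc qS f])
  have q: "quotient_proj r \<in> \<mu> \<rightarrow>\<^sub>M baire ?Q"
    using measurable_quotient_proj measurable_cong_sets[OF \<mu> refl] by blast
  obtain F where F: "F \<in> ?qS" "functionally_closed ?Q F"
      "?Q closure_of {c \<in> \<Union>?qS. f c \<noteq> 0} \<subseteq> F"
    using topologically_consistentD[OF tc] f unfolding test_function_def by meson
  have supp: "{c \<in> \<Union>?qS. f c \<noteq> 0} \<subseteq> F"
    using F(3) qS closure_of_subset[of "{c \<in> \<Union>?qS. f c \<noteq> 0}" ?Q] by blast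
  let ?G = "quotient_proj r -` F \<inter> topspace X"
  (* The value of the pullback outside the carrier is arbitrary; setting it to 0 there makes the
     support a subset of ?G without changing the integrals. *)
  let ?k = "\<lambda>x. indicator (topspace X) x * h (quotient_proj r x)"
  have G: "?G \<in> sets \<mu>"
    using measurable_sets[OF q sets_baire_functionally_closed[OF F(2)]] sp by simp
  have k: "?k \<in> borel_measurable \<mu>"
    using measurable_compose[OF q h] sets.top[of \<mu>] sp by (intro borel_measurable_times) auto
  have "(\<integral>c. h c \<partial>quotient_measure X r S \<mu>) = (\<integral>x. h (quotient_proj r x) \<partial>?R)"
    unfolding quotient_measure_def
    using q h by (intro integral_distr) simp_all
  also have "\<dots> = (\<integral>x. ?k x \<partial>?R)"
    by (intro Bochner_Integration.integral_cong) (auto simp: sp)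
  also have "\<dots> = (\<integral>x. ?k x \<partial>\<mu>)"
  proof (rule integral_restrict_measure_eq[OF G _ k])
    show "?G \<subseteq> \<Union>(saturated_part X r S)"
      by (rule vimage_subset_Union_saturated_part[OF S F(1)])
    show "?k x = 0" if "x \<notin> ?G" for x
      using that supp by (auto simp: h_def zero_extension_def indicator_def)
  qed
  also have "\<dots> = (\<integral>x. h (quotient_proj r x) \<partial>\<mu>)"
    by (intro Bochner_Integration.integral_cong) (auto simp: sp)
  finally show ?thesis .
qed

theorem theorem3p5p5:
  fixes X :: "'a topology"
    and T :: "real \<Rightarrow> 'a \<Rightarrow> 'a"
    and r :: "('a \<times> 'a) set"
    and Tq :: "real \<Rightarrow> 'a set \<Rightarrow> 'a set"
    and S :: "'a set set"
    and g :: "real \<Rightarrow> real"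
    and \<mu> :: "'a measure"
    and P :: "'w measure"
    and \<xi> :: "'w \<Rightarrow> 'a"
  assumes "scaling X T"
    and "equiv (topspace X) r"
    and "\<And>x y t. (x, y) \<in> r \<Longrightarrow> t > 0 \<Longrightarrow> (T t x, T t y) \<in> r"
    and "\<And>x t. x \<in> topspace X \<Longrightarrow> t > 0 \<Longrightarrow> Tq t (quotient_proj r x) = quotient_proj r (T t x)"
    and "ideal_on (topspace X) S"
    and "topologically_consistent X S"
    and "scaling_consistent T S"
    and "scaling (quotient_topology X r) Tq"
    and "topologically_consistent (quotient_topology X r) (quotient_ideal X r S)"
    and "RV P \<xi> X T S g \<mu>"
    and "\<exists>B \<in> saturated_part X r S \<inter> sets (baire X). emeasure \<mu> B > 0"
  shows "RV P (\<lambda>\<omega>. quotient_proj r (\<xi> \<omega>)) (quotient_topology X r) Tq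
           (quotient_ideal X r S) g (quotient_measure X r S \<mu>)"
proof -
  let ?q = "quotient_proj r" and ?Q = "quotient_topology X r"
  let ?qS = "quotient_ideal X r S" and ?\<nu> = "quotient_measure X r S \<mu>"
  note T = \<open>scaling X T\<close> and Tq = \<open>scaling ?Q Tq\<close> and comm = assms(4)
  note ideal = \<open>ideal_on (topspace X) S\<close> and tc = \<open>topologically_consistent ?Q ?qS\<close>
  have P: "prob_space P" and \<xi>: "\<xi> \<in> P \<rightarrow>\<^sub>M baire X"
    and g: "g \<in> borel_measurable (restrict_space borel {0..})" "\<forall>t\<ge>0. g t \<ge> 0"
      "filterlim g at_top at_top"
    and \<mu>: "sets \<mu> = sets (baire X)"
    and fin: "\<forall>B\<in>S \<inter> sets (baire X). emeasure \<mu> B < \<infinity>"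
    and lim: "\<And>f. test_function X S f \<Longrightarrow>
        ((\<lambda>t. g t * (\<integral>\<omega>. zero_extension (\<Union>S) f (T (inverse t) (\<xi> \<omega>)) \<partial>P))
           \<longlongrightarrow> (\<integral>x. zero_extension (\<Union>S) f x \<partial>\<mu>)) at_top"
    using \<open>RV P \<xi> X T S g \<mu>\<close> unfolding RV_def by blast+
  have S: "S \<subseteq> Pow (topspace X)"
    using ideal by (auto simp: ideal_on_def)
  have sp: "space \<mu> = topspace X"
    using sets_eq_imp_space_eq[OF \<mu>] by simp
  have vim: "?q -` C \<inter> topspace X \<in> sets (baire X)" if "C \<in> sets (baire ?Q)" for C
    using measurable_sets[OF measurable_quotient_proj that] by simp
  show ?thesis
    unfolding RV_def
  proof (intro conjI allI impI ballI)
    show "(\<lambda>\<omega>. ?q (\<xi> \<omega>)) \<in> P \<rightarrow>\<^sub>M baire ?Q"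
      by (rule measurable_compose[OF \<xi> measurable_quotient_proj])
    show "ideal_on (topspace ?Q) ?qS"
      by (rule ideal_on_quotient_ideal[OF ideal])
    show "scaling_consistent Tq ?qS"
      by (rule scaling_consistent_quotient_ideal[OF T Tq comm ideal \<open>scaling_consistent T S\<close>])
    show "sets ?\<nu> = sets (baire ?Q)"
      by (simp add: quotient_measure_def)
  next
    fix C assume "C \<in> ?qS \<inter> sets (baire ?Q)"
    then show "emeasure ?\<nu> C < \<infinity>"
      using fin vim quotient_ideal_iff[OF S] by (simp add: emeasure_quotient_measure_ideal[OF \<mu> S])
  next
    fix C assume C: "C \<in> sets (baire ?Q)" "C \<inter> \<Union>?qS = {}"
    have "?q -` C \<inter> topspace X \<inter> \<Union>(saturated_part X r S) = {}"
      using C(2) by (auto simp: quotient_ideal_def)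
    then show "emeasure ?\<nu> C = 0"
      using outer_measure_of_eq[of "{}" \<mu>] by (simp only: emeasure_quotient_measure[OF \<mu> C(1)]) simp
  next
    obtain B where B: "B \<in> saturated_part X r S" "B \<in> sets (baire X)" "emeasure \<mu> B > 0"
      using assms(11) by blast
    then have "?q ` B \<in> ?qS"
      by (simp add: quotient_ideal_def)
    (* The image of B need not be Baire, but a functionally closed set containing it is. *)
    then obtain F where F: "F \<in> ?qS" "functionally_closed ?Q F" "?q ` B \<subseteq> F"
      using topologically_consistentD[OF tc] by meson
    have FB: "F \<in> sets (baire ?Q)"
      by (rule sets_baire_functionally_closed[OF F(2)])
    have "B \<subseteq> ?q -` F \<inter> topspace X"
      using F(3) B(1) S by (auto simp: saturated_part_def)
    then have "emeasure \<mu> B \<le> emeasure ?\<nu> F"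
      using vim[OF FB] by (simp add: emeasure_quotient_measure_ideal[OF \<mu> S FB F(1)] emeasure_mono \<mu>)
    then show "\<exists>C\<in>?qS \<inter> sets (baire ?Q). emeasure ?\<nu> C > 0"
      using F(1) FB B(3) by (intro bexI[of _ F]) auto
  next
    fix f assume f: "test_function ?Q ?qS f"
    define h where "h = zero_extension (\<Union>?qS) f"
    have h_q: "zero_extension (\<Union>S) (\<lambda>x. h (?q x)) x = h (?q x)" if "x \<in> topspace X" for x
    proof -
      have "x \<in> \<Union>S" if "?q x \<in> \<Union>?qS"
        using that \<open>x \<in> topspace X\<close> quotient_ideal_iff[OF S] by blast
      then show ?thesis
        by (auto simp: zero_extension_def h_def)
    qed
    have "((\<lambda>t. g t * (\<integral>\<omega>. zero_extension (\<Union>S) (\<lambda>x. h (?q x)) (T (inverse t) (\<xi> \<omega>)) \<partial>P))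
           \<longlongrightarrow> (\<integral>x. zero_extension (\<Union>S) (\<lambda>x. h (?q x)) x \<partial>\<mu>)) at_top"
      unfolding h_def by (rule lim[OF test_function_pullback[OF ideal tc f]])
    moreover have "(\<integral>x. zero_extension (\<Union>S) (\<lambda>x. h (?q x)) x \<partial>\<mu>) = (\<integral>c. h c \<partial>?\<nu>)"
      unfolding h_def integral_quotient_measure[OF \<mu> ideal tc f]
      by (intro Bochner_Integration.integral_cong) (auto simp: sp h_q[unfolded h_def])
    moreover have "(\<integral>\<omega>. zero_extension (\<Union>S) (\<lambda>x. h (?q x)) (T (inverse t) (\<xi> \<omega>)) \<partial>P) =
        (\<integral>\<omega>. h (Tq (inverse t) (?q (\<xi> \<omega>))) \<partial>P)" if "t > 0" for t
    proof (rule Bochner_Integration.integral_cong[OF refl])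
      fix \<omega> assume "\<omega> \<in> space P"
      then have x: "\<xi> \<omega> \<in> topspace X"
        using measurable_space[OF \<xi>] by simp
      moreover have "T (inverse t) (\<xi> \<omega>) \<in> topspace X"
        using T x that by (auto simp: scaling_def image_subset_iff)
      ultimately show "zero_extension (\<Union>S) (\<lambda>x. h (?q x)) (T (inverse t) (\<xi> \<omega>)) =
          h (Tq (inverse t) (?q (\<xi> \<omega>)))"
        using that by (simp only: h_q comm positive_imp_inverse_positive)
    qed
    ultimately show "((\<lambda>t. g t * (\<integral>\<omega>. zero_extension (\<Union>?qS) f (Tq (inverse t) (?q (\<xi> \<omega>))) \<partial>P))
           \<longlongrightarrow> (\<integral>c. zero_extension (\<Union>?qS) f c \<partial>?\<nu>)) at_top"
      unfolding h_def[symmetric]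
      by (auto elim!: Lim_transform_eventually intro!: eventually_mono[OF eventually_gt_at_top[of 0]])
  qed (use P g tc in auto)
qed

end
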